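(* Let $X$ be a nonempty set of regular choice functions for $L$, and let $K$ be a formal system with $\textsf{Ax}(K)\subseteq Taut(X)$ and whose inference rules are exactly Modus Ponens and $SV$. Then ${\rm PLS}(X,K)$ is sound: for all $\Sigma\cup\{\varphi\}\subseteq Sen(L_s)$, $\Sigma\vdash_K\varphi$ implies $\Sigma\models_X\varphi$.
   Context: $L$ is the propositional language with atoms $p_0,p_1,\ldots$ and connectives $\neg,\wedge$ (others defined); $L_s$ adds a primitive binary connective $|$; $\sim$ is classical equivalence on $Sen(L)$. A choice function for $L$ is a map $f$ with $f(\alpha,\beta)=f(\{\alpha,\beta\})\in\{\alpha,\beta\}$; it is regular if $\alpha\sim\alpha'$ implies $f(\alpha,\beta)\sim f(\alpha',\beta)$. $f$ induces $\overline f:Sen(L_s)\to Sen(L)$: identity on $Sen(L)$, commuting with $\neg,\wedge$, and $\overline f(\varphi|\psi)=f(\overline f(\varphi),\overline f(\psi))$. $\langle M,f\rangle\models_s\varphi$ iff $M\models\overline f(\varphi)$ ($M$ a classical truth assignment). $\Sigma\models_X\varphi$: every $\langle M,f\rangle$, $f\in X$, satisfying $\Sigma$ satisfies $\varphi$; $Taut(X)=\{\varphi:\emptyset\models_X\varphi\}$. $K_0$ is the system whose axioms are all $L_s$-instances of the schemes $\varphi\rightarrow(\psi\rightarrow\varphi)$, $(\varphi\rightarrow(\psi\rightarrow\sigma))\rightarrow((\varphi\rightarrow\psi)\rightarrow(\varphi\rightarrow\sigma))$, $(\neg\varphi\rightarrow\neg\psi)\rightarrow((\neg\varphi\rightarrow\psi)\rightarrow\varphi)$,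 $\varphi\wedge\psi\rightarrow\varphi|\psi$, $\varphi|\psi\rightarrow\varphi\vee\psi$, $\varphi|\psi\rightarrow\psi|\varphi$, with Modus Ponens as sole rule. The rule $SV$: from $\varphi\leftrightarrow\psi$ infer $\varphi|\sigma\leftrightarrow\psi|\sigma$ (any $\sigma$), provided $\varphi\leftrightarrow\psi$ is provable in $K_0$ (from no premises). $\Sigma\vdash_K\varphi$ means there is a finite sequence ending in $\varphi$ each member of which is in $\Sigma$, is an axiom of $K$, or follows from earlier members by a rule of $K$. *)

theory Defs
  imports Main "HOL-Library.Uprod"
begin

datatype fm =
    Atom nat
  | Neg fm
  | Conj fm fm

type_synonym assignment = "nat \<Rightarrow> bool"

primrec eval :: "assignment \<Rightarrow> fm \<Rightarrow> bool" where
  "eval M (Atom n) = M n"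
| "eval M (Neg \<alpha>) = (\<not> eval M \<alpha>)"
| "eval M (Conj \<alpha> \<beta>) = (eval M \<alpha> \<and> eval M \<beta>)"

definition fm_equiv :: "fm \<Rightarrow> fm \<Rightarrow> bool" (infix "\<sim>" 50) where
  "\<alpha> \<sim> \<beta> \<longleftrightarrow> (\<forall>M. eval M \<alpha> = eval M \<beta>)"

datatype sfm =
    SAtom nat
  | SNeg sfm  ("\<^bold>\<not> _" [75] 75)
  | SConj sfm sfm  (infixr "\<^bold>\<and>" 65)
  | SSup sfm sfm  (infix "\<^bold>\<bar>" 70)

abbreviation SImp :: "sfm \<Rightarrow> sfm \<Rightarrow> sfm" (infixr "\<^bold>\<rightarrow>" 55) where
  "\<phi> \<^bold>\<rightarrow> \<psi> \<equiv> \<^bold>\<not> (\<phi> \<^bold>\<and> \<^bold>\<not> \<psi>)"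

abbreviation SDisj :: "sfm \<Rightarrow> sfm \<Rightarrow> sfm" (infixr "\<^bold>\<or>" 60) where
  "\<phi> \<^bold>\<or> \<psi> \<equiv> \<^bold>\<not> (\<^bold>\<not> \<phi> \<^bold>\<and> \<^bold>\<not> \<psi>)"

abbreviation SIff :: "sfm \<Rightarrow> sfm \<Rightarrow> sfm" (infix "\<^bold>\<leftrightarrow>" 50) where
  "\<phi> \<^bold>\<leftrightarrow> \<psi> \<equiv> (\<phi> \<^bold>\<rightarrow> \<psi>) \<^bold>\<and> (\<psi> \<^bold>\<rightarrow> \<phi>)"

(* Choice functions act on unordered pairs, including the degenerate pair
   Upair \<alpha> \<alpha>, which encodes the singleton {\<alpha>}. *)
type_synonym selector = "fm uprod \<Rightarrow> fm"

definition choice_function :: "selector \<Rightarrow> bool" where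
  "choice_function f \<longleftrightarrow> (\<forall>\<alpha> \<beta>. f (Upair \<alpha> \<beta>) \<in> {\<alpha>, \<beta>})"

definition regular :: "selector \<Rightarrow> bool" where
  "regular f \<longleftrightarrow>
     (\<forall>\<alpha> \<alpha>' \<beta>. \<alpha> \<sim> \<alpha>' \<longrightarrow> f (Upair \<alpha> \<beta>) \<sim> f (Upair \<alpha>' \<beta>))"

primrec collapse :: "selector \<Rightarrow> sfm \<Rightarrow> fm" where
  "collapse f (SAtom n) = Atom n"
| "collapse f (\<^bold>\<not> \<phi>) = Neg (collapse f \<phi>)"
| "collapse f (\<phi> \<^bold>\<and> \<psi>) = Conj (collapse f \<phi>) (collapse f \<psi>)"
| "collapse f (\<phi> \<^bold>\<bar> \<psi>) = f (Upair (collapse f \<phi>) (collapse f \<psi>))"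

(* The inclusion of Sen(L) in Sen(L_s); the lemma below is the clause that
   the extension of f to Sen(L_s) is the identity on Sen(L). *)
primrec embed :: "fm \<Rightarrow> sfm" where
  "embed (Atom n) = SAtom n"
| "embed (Neg \<alpha>) = \<^bold>\<not> embed \<alpha>"
| "embed (Conj \<alpha> \<beta>) = embed \<alpha> \<^bold>\<and> embed \<beta>"

lemma collapse_embed: "collapse f (embed \<alpha>) = \<alpha>"
  by (induction \<alpha>) simp_all

definition sat :: "assignment \<Rightarrow> selector \<Rightarrow> sfm \<Rightarrow> bool" where
  "sat M f \<phi> \<longleftrightarrow> eval M (collapse f \<phi>)"

definition entails :: "selector set \<Rightarrow> sfm set \<Rightarrow> sfm \<Rightarrow> bool" where
  "entails X \<Sigma> \<phi> \<longleftrightarrow>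
     (\<forall>M. \<forall>f\<in>X. (\<forall>\<sigma>\<in>\<Sigma>. sat M f \<sigma>) \<longrightarrow> sat M f \<phi>)"

definition Taut :: "selector set \<Rightarrow> sfm set" where
  "Taut X = {\<phi>. entails X {} \<phi>}"

(* A rule is the set of its instances (premises, conclusion); the rules field
   is the union of all rules of the system. *)
record formal_system =
  Ax :: "sfm set"
  Rules :: "(sfm set \<times> sfm) set"

definition derivation :: "formal_system \<Rightarrow> sfm set \<Rightarrow> sfm list \<Rightarrow> bool" where
  "derivation K \<Sigma> \<phi>s \<longleftrightarrow>
     (\<forall>i < length \<phi>s.
        \<phi>s ! i \<in> \<Sigma> \<or> \<phi>s ! i \<in> Ax K \<or>
        (\<exists>P. (P, \<phi>s ! i) \<in> Rules K \<and> P \<subseteq> set (take i \<phi>s)))"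

definition derives :: "formal_system \<Rightarrow> sfm set \<Rightarrow> sfm \<Rightarrow> bool" where
  "derives K \<Sigma> \<phi> \<longleftrightarrow>
     (\<exists>\<phi>s. \<phi>s \<noteq> [] \<and> last \<phi>s = \<phi> \<and> derivation K \<Sigma> \<phi>s)"

definition MP :: "(sfm set \<times> sfm) set" where
  "MP = {({\<phi>, \<phi> \<^bold>\<rightarrow> \<psi>}, \<psi>) | \<phi> \<psi>. True}"

definition K0_axioms :: "sfm set" where
  "K0_axioms =
     {\<phi> \<^bold>\<rightarrow> (\<psi> \<^bold>\<rightarrow> \<phi>) | \<phi> \<psi>. True} \<union>
     {(\<phi> \<^bold>\<rightarrow> (\<psi> \<^bold>\<rightarrow> \<sigma>)) \<^bold>\<rightarrow> ((\<phi> \<^bold>\<rightarrow> \<psi>) \<^bold>\<rightarrow> (\<phi> \<^bold>\<rightarrow> \<sigma>)) | \<phi> \<psi> \<sigma>. True} \<union>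
     {(\<^bold>\<not> \<phi> \<^bold>\<rightarrow> \<^bold>\<not> \<psi>) \<^bold>\<rightarrow> ((\<^bold>\<not> \<phi> \<^bold>\<rightarrow> \<psi>) \<^bold>\<rightarrow> \<phi>) | \<phi> \<psi>. True} \<union>
     {(\<phi> \<^bold>\<and> \<psi>) \<^bold>\<rightarrow> (\<phi> \<^bold>\<bar> \<psi>) | \<phi> \<psi>. True} \<union>
     {(\<phi> \<^bold>\<bar> \<psi>) \<^bold>\<rightarrow> (\<phi> \<^bold>\<or> \<psi>) | \<phi> \<psi>. True} \<union>
     {(\<phi> \<^bold>\<bar> \<psi>) \<^bold>\<rightarrow> (\<psi> \<^bold>\<bar> \<phi>) | \<phi> \<psi>. True}"

definition K0 :: formal_system where
  "K0 = \<lparr>Ax = K0_axioms, Rules = MP\<rparr>"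

definition SV :: "(sfm set \<times> sfm) set" where
  "SV = {({\<phi> \<^bold>\<leftrightarrow> \<psi>}, (\<phi> \<^bold>\<bar> \<sigma>) \<^bold>\<leftrightarrow> (\<psi> \<^bold>\<bar> \<sigma>)) | \<phi> \<psi> \<sigma>.
           derives K0 {} (\<phi> \<^bold>\<leftrightarrow> \<psi>)}"

end

theory Submission
  imports Defs
begin

text \<open>Satisfaction in a fixed model is preserved along derivations as soon as the axioms hold
  in it and the rules preserve it. Modus Ponens preserves it in every model. The side condition of
  SV makes its premise a theorem of K0, hence true in all models of a choice function, not
  only in the one under consideration; so the two collapsed formulas are classically equivalent and
  regularity applies.\<close>

text \<open>Kept general in \<open>K\<close> because it is applied twice: to \<open>K0\<close> with
  no premises, for the side condition of \<open>SV\<close>, and to the system of the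
  theorem.\<close>

lemma derives_sat:
  assumes "derives K \<Sigma> \<phi>"
    and hyps: "\<forall>\<sigma>\<in>\<Sigma>. sat M f \<sigma>"
    and axs: "\<forall>\<sigma>\<in>Ax K. sat M f \<sigma>"
    and rules: "\<And>P \<psi>. (P, \<psi>) \<in> Rules K \<Longrightarrow> \<forall>\<sigma>\<in>P. sat M f \<sigma> \<Longrightarrow> sat M f \<psi>"
  shows "sat M f \<phi>"
proof -
  obtain \<phi>s where \<phi>s: "\<phi>s \<noteq> []" "last \<phi>s = \<phi>" "derivation K \<Sigma> \<phi>s"
    using assms(1) unfolding derives_def by blast
  have "sat M f (\<phi>s ! i)" if "i < length \<phi>s" for i
    using that
  proof (induction i rule: less_induct)
    case (less i)
    \<comment> \<open>The premises of a rule applied at position \<open>i\<close> occur at smaller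
      indices, where the induction hypothesis holds.\<close>
    have "\<forall>\<sigma>\<in>set (take i \<phi>s). sat M f \<sigma>"
      using less by (auto simp: in_set_conv_nth)
    then show ?case
      using \<phi>s(3) less.prems hyps axs rules unfolding derivation_def by blast
  qed
  then show ?thesis
    using \<phi>s(1,2) by (auto simp: last_conv_nth)
qed

lemma MP_sat:
  assumes "(P, \<psi>) \<in> MP" and "\<forall>\<sigma>\<in>P. sat M f \<sigma>"
  shows "sat M f \<psi>"
  using assms by (auto simp: MP_def sat_def)

text \<open>The first three schemes are classical tautologies. The next two hold because
  \<open>f\<close> returns one of its two arguments, so its value is true if both are and false if
  neither is. The last holds because \<open>Upair\<close> is unordered: both sides of the
  implication collapse to the same formula.\<close>

lemma K0_axioms_sat:
  assumes "choice_function f" and "\<phi> \<in> K0_axioms"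
  shows "sat M f \<phi>"
proof -
  have choice: "f (Upair \<alpha> \<beta>) = \<alpha> \<or> f (Upair \<alpha> \<beta>) = \<beta>" for \<alpha> \<beta>
    using assms(1) unfolding choice_function_def by blast
  have both: "sat M f ((\<alpha> \<^bold>\<and> \<beta>) \<^bold>\<rightarrow> (\<alpha> \<^bold>\<bar> \<beta>))" for \<alpha> \<beta>
    using choice[of "collapse f \<alpha>" "collapse f \<beta>"] by (auto simp: sat_def)
  have either: "sat M f ((\<alpha> \<^bold>\<bar> \<beta>) \<^bold>\<rightarrow> (\<alpha> \<^bold>\<or> \<beta>))" for \<alpha> \<beta>
    using choice[of "collapse f \<alpha>" "collapse f \<beta>"] by (auto simp: sat_def)
  have "Upair \<alpha> \<beta> = Upair \<beta> \<alpha>" for \<alpha> \<beta> :: fm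
    by auto
  then have comm: "sat M f ((\<alpha> \<^bold>\<bar> \<beta>) \<^bold>\<rightarrow> (\<beta> \<^bold>\<bar> \<alpha>))" for \<alpha> \<beta>
    by (metis collapse.simps(4) eval.simps(2,3) collapse.simps(2,3) sat_def)
  show ?thesis
    using assms(2) unfolding K0_axioms_def
    by (elim UnE CollectE exE conjE; hypsubst)
      (rule both either comm | simp add: sat_def; blast)+
qed

lemma K0_sound:
  assumes "choice_function f" and "derives K0 {} \<phi>"
  shows "sat M f \<phi>"
  using assms(2)
  by (rule derives_sat) (auto simp: K0_def intro: K0_axioms_sat[OF assms(1)] MP_sat)

lemma SV_sat:
  assumes "choice_function f" and "regular f" and "(P, \<psi>) \<in> SV"
  shows "sat M f \<psi>"
proof -
  obtain \<alpha> \<beta> \<sigma> where \<psi>: "\<psi> = ((\<alpha> \<^bold>\<bar> \<sigma>) \<^bold>\<leftrightarrow> (\<beta> \<^bold>\<bar> \<sigma>))"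
    and "derives K0 {} (\<alpha> \<^bold>\<leftrightarrow> \<beta>)"
    using assms(3) unfolding SV_def by blast
  \<comment> \<open>\<open>N\<close> is independent of \<open>M\<close>: with \<open>f\<close>
    fixed, the equivalence of the two collapsed formulas ranges over all assignments.\<close>
  then have "sat N f (\<alpha> \<^bold>\<leftrightarrow> \<beta>)" for N
    using K0_sound assms(1) by blast
  then have "collapse f \<alpha> \<sim> collapse f \<beta>"
    by (auto simp: sat_def fm_equiv_def)
  then have "collapse f (\<alpha> \<^bold>\<bar> \<sigma>) \<sim> collapse f (\<beta> \<^bold>\<bar> \<sigma>)"
    using assms(2) by (simp add: regular_def)
  then show ?thesis
    by (auto simp: \<psi> sat_def fm_equiv_def)
qed

theorem theorem3p12:
  fixes X :: "selector set" and K :: formal_system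
  assumes "X \<noteq> {}"
    and "\<forall>f\<in>X. choice_function f \<and> regular f"
    and "Ax K \<subseteq> Taut X"
    and "Rules K = MP \<union> SV"
  shows "\<forall>\<Sigma> \<phi>. derives K \<Sigma> \<phi> \<longrightarrow> entails X \<Sigma> \<phi>"
proof (intro allI impI)
  fix \<Sigma> \<phi>
  assume "derives K \<Sigma> \<phi>"
  then have "sat M f \<phi>" if "f \<in> X" and "\<forall>\<sigma>\<in>\<Sigma>. sat M f \<sigma>" for M f
  proof (rule derives_sat)
    show "\<forall>\<sigma>\<in>\<Sigma>. sat M f \<sigma>"
      by (fact that(2))
    \<comment> \<open>Membership in \<open>Taut X\<close> is entailment from the empty set, so it
      gives truth at \<open>M\<close> and \<open>f\<close> outright.\<close>
    show "\<forall>\<sigma>\<in>Ax K. sat M f \<sigma>"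
      using assms(3) that(1) by (auto simp: Taut_def entails_def)
    show "sat M f \<psi>" if "(P, \<psi>) \<in> Rules K" "\<forall>\<sigma>\<in>P. sat M f \<sigma>" for P \<psi>
      using that assms(2,4) \<open>f \<in> X\<close> by (auto intro: MP_sat SV_sat)
  qed
  then show "entails X \<Sigma> \<phi>"
    by (simp add: entails_def)
qed

end
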